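(* For every integer $m\ge1$, \[\psi(z_m)-\log z_m\log\log z_m<\log n_m\le\psi(z_m).\]
   Context: $\psi(x):=\sum_{p^k\le x}\log p$ is the Chebyshev psi function. Consider all pairs $(q,k)$ with $q$ prime and $k\ge 1$ an integer, with value $z_{q,k}:=q+q^2+\cdots+q^k$. Enumerate these pairs as $(q_1,k_1),(q_2,k_2),\dots$ so that $z_i:=z_{q_i,k_i}$ is nondecreasing in $i$; if $z_{q,k}=z_{p,j}$ with $q>p$, then $(q,k)$ comes before $(p,j)$. For $m\ge1$ let $E_m$ be the set of the first $m$ pairs; for each prime $p$ let $k_p$ be the largest $k$ with $(p,k)\in E_m$ ($k_p=0$ if none), and $n_m:=\prod_p p^{k_p}$.
   Formalization: The lower bound is asserted only for m ≥ 2: at m = 1 one has z_1 = n_1 = 2 and ψ(2) = log 2, and since log log 2 < 0 the strict lower bound fails there; the upper bound is kept for all m ≥ 1. *)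

theory Defs
  imports Complex_Main "HOL-Computational_Algebra.Primes" "HOL-Library.Infinite_Set"
begin

definition chebyshev_psi :: "real \<Rightarrow> real" where
  "chebyshev_psi x = (\<Sum>(p, k) \<in> {(p, k). prime p \<and> k \<ge> 1 \<and> real (p ^ k) \<le> x}. ln (real p))"

definition prime_pairs :: "(nat \<times> nat) set" where
  "prime_pairs = {(q, k). prime q \<and> k \<ge> 1}"

definition pair_value :: "nat \<times> nat \<Rightarrow> nat" where
  "pair_value = (\<lambda>(q, k). \<Sum>i = 1..k. q ^ i)"

text \<open>The enumeration is indexed from 1; the value of \<open>e\<close> at 0 is irrelevant.
  The conditions determine \<open>e\<close> on positive indices, since \<open>pair_value (q, k)\<close>
  and \<open>q\<close> together determine \<open>k\<close>.\<close>

definition pair_enumeration :: "(nat \<Rightarrow> nat \<times> nat) \<Rightarrow> bool" where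
  "pair_enumeration e \<longleftrightarrow>
     bij_betw e {1..} prime_pairs \<and>
     (\<forall>i\<ge>1. \<forall>j\<ge>i. pair_value (e i) \<le> pair_value (e j)) \<and>
     (\<forall>i\<ge>1. \<forall>j\<ge>1. pair_value (e i) = pair_value (e j) \<and> fst (e i) > fst (e j) \<longrightarrow> i < j)"

definition first_pairs :: "(nat \<Rightarrow> nat \<times> nat) \<Rightarrow> nat \<Rightarrow> (nat \<times> nat) set" where
  "first_pairs e m = e ` {1..m}"

definition max_exponent :: "(nat \<times> nat) set \<Rightarrow> nat \<Rightarrow> nat" where
  "max_exponent E p = (if \<exists>k. (p, k) \<in> E then Max {k. (p, k) \<in> E} else 0)"

text \<open>The product is restricted to primes with nonzero exponent, because a product over
  the infinite set of all primes would be 1 by convention.\<close>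

definition pairs_number :: "(nat \<times> nat) set \<Rightarrow> nat" where
  "pairs_number E = (\<Prod>p | prime p \<and> max_exponent E p \<noteq> 0. p ^ max_exponent E p)"

lemma pair_value_ge: "(q, k) \<in> prime_pairs \<Longrightarrow> q \<le> pair_value (q, k)"
proof -
  assume "(q, k) \<in> prime_pairs"
  then have "k \<ge> 1" by (simp add: prime_pairs_def)
  then have "q ^ 1 \<le> (\<Sum>i = 1..k. q ^ i)"
    by (intro member_le_sum) auto
  then show ?thesis by (simp add: pair_value_def)
qed

lemma pair_value_inj:
  assumes "(q, k) \<in> prime_pairs" "(q, j) \<in> prime_pairs" "pair_value (q, k) = pair_value (q, j)"
  shows "k = j"
proof -
  have q: "q > 0" using assms(1) by (auto simp: prime_pairs_def prime_gt_0_nat)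
  have "strict_mono (\<lambda>k. \<Sum>i = 1..k. q ^ i)"
    by (rule strict_mono_Suc_iff[THEN iffD2]) (use q in simp)
  then have "inj (\<lambda>k. \<Sum>i = 1..k. q ^ i)" by (rule strict_mono_imp_inj_on)
  then show ?thesis using assms(3) unfolding pair_value_def case_prod_conv by (rule injD)
qed

lemma pair_enumeration_exists: "\<exists>e. pair_enumeration e"
proof -
  define z where "z = pair_value"
  define c where "c = (\<lambda>x. z x * (z x + 1) + (z x - fst x))"
  have lt: "c x < c y" if "z x < z y" for x y
  proof -
    have "c x < z x * (z x + 1) + (z x + 1)" by (simp add: c_def)
    also have "\<dots> = (z x + 1) * (z x + 1)" by (simp add: algebra_simps)
    also have "\<dots> \<le> z y * (z y + 1)" using that by (intro mult_mono) auto
    also have "\<dots> \<le> c y" by (simp add: c_def)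
    finally show ?thesis .
  qed
  have inj: "inj_on c prime_pairs"
  proof (rule inj_onI)
    fix x y assume x: "x \<in> prime_pairs" and y: "y \<in> prime_pairs" and "c x = c y"
    then have zz: "z x = z y" using lt by (metis less_irrefl nat_neq_iff)
    have "fst x \<le> z x" "fst y \<le> z y"
      using x y pair_value_ge by (metis prod.collapse z_def)+
    with zz \<open>c x = c y\<close> have f: "fst x = fst y" by (simp add: c_def)
    then have "snd x = snd y"
      using pair_value_inj x y zz by (metis prod.collapse z_def)
    with f show "x = y" by (simp add: prod_eq_iff)
  qed
  have "infinite prime_pairs"
  proof
    assume "finite prime_pairs"
    moreover have "(\<lambda>p. (p, 1)) ` {p. prime p} \<subseteq> prime_pairs" by (auto simp: prime_pairs_def)
    ultimately have "finite ((\<lambda>p. (p, 1::nat)) ` {p::nat. prime p})" by (rule rev_finite_subset)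
    then have "finite {p::nat. prime p}" by (rule finite_imageD) (auto simp: inj_on_def)
    then show False using primes_infinite by blast
  qed
  then have infC: "infinite (c ` prime_pairs)" using inj finite_imageD by blast
  define e where "e = (\<lambda>i. inv_into prime_pairs c (enumerate (c ` prime_pairs) (i - 1)))"
  have ce: "c (e i) = enumerate (c ` prime_pairs) (i - 1)" for i
    unfolding e_def using enumerate_in_set[OF infC] by (rule f_inv_into_f)
  have mono: "c (e i) < c (e j)" if "1 \<le> i" "i < j" for i j
    unfolding ce using that by (intro enumerate_mono[OF _ infC]) auto
  have "bij_betw (\<lambda>i. i - 1) {1..} (UNIV :: nat set)"
    by (rule bij_betw_byWitness[where f' = Suc]) auto
  moreover have "bij_betw (enumerate (c ` prime_pairs)) UNIV (c ` prime_pairs)"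
    by (rule bij_enumerate[OF infC])
  moreover have "bij_betw (inv_into prime_pairs c) (c ` prime_pairs) prime_pairs"
    by (intro bij_betw_inv_into inj_on_imp_bij_betw inj)
  ultimately have bij: "bij_betw e {1..} prime_pairs"
    unfolding e_def using bij_betw_trans[OF bij_betw_trans] by (fastforce simp: o_def)
  moreover have "z (e i) \<le> z (e j)" if "1 \<le> i" "i \<le> j" for i j
    using lt[of "e j" "e i"] mono[OF that(1), of j] that by (cases "i = j") (auto simp: not_less[symmetric])
  moreover have "i < j" if "1 \<le> i" "1 \<le> j" "z (e i) = z (e j)" "fst (e i) > fst (e j)" for i j
  proof (rule ccontr)
    assume "\<not> i < j"
    then consider "i = j" | "j < i" by linarith
    then show False
    proof cases
      case 1 then show False using that(4) by simp
    next
      case 2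
      from mono[OF that(2) 2] have "c (e j) < c (e i)" .
      moreover have "c (e i) \<le> c (e j)" using that(3,4) by (simp add: c_def)
      ultimately show False by simp
    qed
  qed
  ultimately show ?thesis unfolding pair_enumeration_def z_def by blast
qed

text \<open>The first pair is \<open>(2, 1)\<close>, with value 2. Since \<open>ln (ln 2) < 0\<close>,
  the lower bound for \<open>ln (pairs_number (first_pairs e m))\<close> in terms of the psi
  function is false at \<open>m = 1\<close>.\<close>

lemma lower_bound_fails_at_1:
  assumes e: "pair_enumeration e"
  defines "z \<equiv> real (pair_value (e 1))"
  shows "\<not> chebyshev_psi z - ln z * ln (ln z) < ln (real (pairs_number (first_pairs e 1)))"
proof -
  have two: "(2, 1) \<in> prime_pairs" by (simp add: prime_pairs_def)
  have bij: "e ` {1..} = prime_pairs" using e by (simp add: pair_enumeration_def bij_betw_def)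
  then obtain j where j: "j \<ge> 1" "e j = (2, 1)" using two by (metis atLeast_iff imageE)
  have "pair_value (e 1) \<le> pair_value (e j)"
    using e j(1) unfolding pair_enumeration_def by blast
  then have le: "pair_value (e 1) \<le> 2" by (simp add: j(2) pair_value_def)
  obtain q k where qk: "e 1 = (q, k)" by fastforce
  have P: "(q, k) \<in> prime_pairs" using bij qk by (metis atLeast_iff imageI order_refl)
  have q2: "q = 2"
    using pair_value_ge[OF P] le qk P prime_ge_2_nat[of q] by (simp add: prime_pairs_def)
  have "(2::nat) ^ k \<le> (\<Sum>i = 1..k. 2 ^ i)"
    by (rule member_le_sum) (use P in \<open>auto simp: prime_pairs_def\<close>)
  then have "(2::nat) ^ k \<le> 2 ^ 1" using le qk q2 by (simp add: pair_value_def)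
  then have "k \<le> 1" using power_le_imp_le_exp[of "2::nat" k 1] by simp
  then have k1: "k = 1" using P by (simp add: prime_pairs_def)
  have e1: "e 1 = (2, 1)" using qk q2 k1 by simp
  have z: "z = 2" unfolding z_def e1 by (simp add: pair_value_def)
  have "max_exponent (first_pairs e 1) p = (if p = 2 then 1 else 0)" for p
    using e1 by (simp add: max_exponent_def first_pairs_def)
  then have n: "pairs_number (first_pairs e 1) = 2"
    by (simp add: pairs_number_def)
  have "{(p, k). prime p \<and> k \<ge> 1 \<and> real (p ^ k) \<le> 2} = {(2, 1)}"
  proof (intro equalityI subsetI)
    fix x assume "x \<in> {(p, k). prime p \<and> k \<ge> 1 \<and> real (p ^ k) \<le> 2}"
    then obtain p k where x: "x = (p, k)" "prime p" "k \<ge> 1" "real (p ^ k) \<le> real 2" by auto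
    then have pk: "p ^ k \<le> 2" by (subst (asm) of_nat_le_iff)
    have p: "p \<ge> 2" using x prime_ge_2_nat by blast
    have "p ^ 1 \<le> p ^ k" using x(3) p by (intro power_increasing) auto
    then have "p = 2" using p pk by simp
    moreover from this have "k \<le> 1" using pk power_le_imp_le_exp[of "2::nat" k 1] by simp
    ultimately show "x \<in> {(2, 1)}" using x by simp
  qed auto
  then have psi: "chebyshev_psi 2 = ln 2" by (simp add: chebyshev_psi_def)
  have "ln (2::real) < 1" "ln (2::real) > 0" using ln_less_self[of "2::real"] ln_2_less_1 by auto
  then have "ln (2::real) * ln (ln 2) < 0" by (intro mult_pos_neg) auto
  then show ?thesis unfolding z n by (simp add: psi)
qed

end

(*
  A prime power p^k \<le> z that is missing from E_m satisfies p^k \<le> z \<le> p + ... + p^k; moreover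
  k \<ge> 2, because the tie-breaking rule puts (z, 1) first among the pairs of value z.
  Since p + ... + p^k < p^(k+1), each p has at most one such k, and since p + ... + p^k < (p+1)^k,
  each k has at most one such p.  So the missing primes contribute at most ln 2 for p = 2 and
  at most ln z / k for each k with 2 \<le> k \<le> ln z / ln 3, and the harmonic sum
  is smaller than ln (ln z) once z \<ge> 16.  For z < 16 only p = 2 and p = 3 occur.
*)

theory Submission
  imports Defs "HOL-Analysis.Complex_Transcendental"
begin

section \<open>The values of the pairs\<close>

lemma pair_value_Suc: "pair_value (p, Suc k) = pair_value (p, k) + p ^ Suc k"
  by (simp add: pair_value_def)

lemma pair_value_strict_mono:
  assumes "p > 0" "j < k"
  shows "pair_value (p, j) < pair_value (p, k)"
  using \<open>j < k\<close> by (rule lift_Suc_mono_less[rotated]) (use assms in \<open>simp add: pair_value_Suc\<close>)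

lemma power_le_pair_value: "k \<ge> 1 \<Longrightarrow> p ^ k \<le> pair_value (p, k)"
  by (cases k) (simp_all add: pair_value_Suc)

text \<open>By induction the earlier terms stay below the next power, so adding that power less than
  doubles it, and \<open>2 \<le> p\<close> absorbs the factor 2.\<close>

lemma pair_value_less_power_Suc:
  assumes "p \<ge> 2"
  shows "pair_value (p, k) < p ^ Suc k"
proof (induction k)
  case 0
  then show ?case using assms by (simp add: pair_value_def)
next
  case (Suc k)
  have "pair_value (p, Suc k) < 2 * p ^ Suc k"
    using Suc by (simp add: pair_value_Suc)
  also have "\<dots> \<le> p * p ^ Suc k" using assms by (intro mult_right_mono) auto
  finally show ?case by simp
qed

text \<open>Split \<open>Suc p ^ Suc k\<close> as \<open>Suc p ^ k + p * Suc p ^ k\<close>: the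
  first summand exceeds the earlier terms by induction, the second dominates the new term
  \<open>p ^ Suc k\<close>.\<close>

lemma pair_value_less_Suc_power: "pair_value (p, k) < Suc p ^ k"
proof (induction k)
  case 0
  then show ?case by (simp add: pair_value_def)
next
  case (Suc k)
  have "p * p ^ k \<le> p * Suc p ^ k" by (intro mult_left_mono power_mono) auto
  from add_less_le_mono[OF Suc this] show ?case by (simp add: pair_value_Suc)
qed

text \<open>None of the three numbers is prime, \<open>q * (q + 1)\<close> is 6 or at least 12, and
  three or more terms sum to at least 14. These numbers lie outside the ranges treated by
  \<open>sum_ln_gap_pairs_small\<close>; at 4 and 9 its bound is false, since the sums there are
  \<open>ln 2\<close> and \<open>ln 6\<close>.\<close>

lemma pair_value_notin:
  assumes "(q, k) \<in> prime_pairs"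
  shows "pair_value (q, k) \<notin> {4, 9, 10}"
proof -
  have q: "prime q" and "k \<ge> 1" using assms by (auto simp: prime_pairs_def)
  then consider "k = 1" | "k = 2" | "k \<ge> 3" by linarith
  then show ?thesis
  proof cases
    case 1
    have "\<not> prime (4::nat)" "\<not> prime (9::nat)" "\<not> prime (10::nat)"
      using prime_product[of 2 2] prime_product[of 3 3] prime_product[of 2 5] by auto
    then show ?thesis using q 1 by (auto simp: pair_value_def)
  next
    case 2
    have v: "pair_value (q, k) = q * (q + 1)"
      by (simp add: pair_value_def 2 numeral_2_eq_2)
    have "q = 2 \<or> q \<ge> 3" using prime_ge_2_nat[OF q] by linarith
    then show ?thesis
    proof
      assume "q \<ge> 3"
      then have "3 * (3 + 1) \<le> q * (q + 1)" by (intro mult_mono) auto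
      then show ?thesis unfolding v by auto
    next
      assume "q = 2"
      then show ?thesis unfolding v by simp
    qed
  next
    case 3
    have "14 = (\<Sum>i = 1..3. 2 ^ i :: nat)" by (simp add: numeral_3_eq_3)
    also have "\<dots> \<le> (\<Sum>i = 1..3. q ^ i)"
      by (intro sum_mono power_mono prime_ge_2_nat q) auto
    also have "\<dots> \<le> (\<Sum>i = 1..k. q ^ i)"
      using 3 by (intro sum_mono2) auto
    finally show ?thesis by (auto simp: pair_value_def)
  qed
qed

section \<open>Numerical bounds\<close>

text \<open>Certifies a numerical bound by rational arithmetic: raise both sides to the power
  \<open>b\<close> and replace \<open>exp 1\<close> by the larger 2.72.\<close>

lemma exp_less_of_power:
  fixes y :: real and a b :: nat
  assumes "b > 0" "y \<ge> 0" "(272 / 100) ^ a < y ^ b"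
  shows "exp (a / b) < y"
proof (rule power_less_imp_less_base)
  have "exp (a / b) ^ b = exp (1::real) ^ a"
    using assms(1) by (simp flip: exp_of_nat_mult)
  also have "\<dots> \<le> (272 / 100) ^ a" using e_less_272 by (intro power_mono) auto
  finally show "exp (a / b) ^ b < y ^ b" using assms(3) by simp
qed (use assms in auto)

lemma less_ln_of_power:
  fixes y :: real and a b :: nat
  assumes "b > 0" "y > 0" "(272 / 100) ^ a < y ^ b"
  shows "a / b < ln y"
proof -
  have "exp (a / b) < exp (ln y)" using exp_less_of_power[of b y a] assms by simp
  then show ?thesis by (simp only: exp_less_cancel_iff)
qed

text \<open>Since \<open>3 > exp 1\<close>, both factors are positive and increasing from 3 on. A
  comparison with a constant therefore needs checking only at the left end of a range.\<close>

lemma ln_mult_ln_ln_mono: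
  fixes x y :: real
  assumes "3 \<le> x" "x \<le> y"
  shows "0 < ln x * ln (ln x)" "ln x * ln (ln x) \<le> ln y * ln (ln y)"
proof -
  have "ln (3::real) > 1" using less_ln_of_power[of 1 3 1] by (simp add: power_divide)
  moreover have "ln 3 \<le> ln x" "ln x \<le> ln y" using assms by auto
  ultimately have "1 < ln x" "ln x \<le> ln y" by linarith+
  then show "0 < ln x * ln (ln x)" "ln x * ln (ln x) \<le> ln y * ln (ln y)"
    by (auto intro!: mult_mono)
qed

lemma ln_2_less: "ln 2 < ln 5 * ln (ln (5::real))"
proof -
  have "8 / 5 < ln (5::real)" using less_ln_of_power[of 5 5 8] by (simp add: power_divide)
  moreover have "9 / 20 < ln (8 / 5 :: real)"
    using less_ln_of_power[of 20 "8/5" 9] by (simp add: power_divide)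
  ultimately have *: "9 / 20 < ln (ln (5::real))"
    using ln_less_cancel_iff[of "8/5::real" "ln 5"] by linarith
  \<comment> \<open>With \<open>ln (ln 5)\<close> replaced by 9/20, the claim becomes the integer
    inequality \<open>2 ^ 20 \<le> 5 ^ 9\<close>.\<close>
  have "20 * ln (2::real) = ln (2 ^ 20)" by (simp only: ln_realpow)
  also have "\<dots> \<le> ln (5 ^ 9)" by simp
  also have "\<dots> = 9 * ln 5" by (simp only: ln_realpow)
  finally have "ln 2 \<le> ln 5 * (9 / 20 :: real)" by simp
  also have "\<dots> < ln 5 * ln (ln 5)" using * by (intro mult_strict_left_mono) auto
  finally show ?thesis .
qed

lemma ln_6_less: "ln 6 < ln 11 * ln (ln (11::real))"
proof -
  have "19 / 8 < ln (11::real)" using less_ln_of_power[of 8 11 19] by (simp add: power_divide)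
  moreover have "4 / 5 < ln (19 / 8 :: real)"
    using less_ln_of_power[of 5 "19/8" 4] by (simp add: power_divide)
  ultimately have *: "4 / 5 < ln (ln (11::real))"
    using ln_less_cancel_iff[of "19/8::real" "ln 11"] by linarith
  \<comment> \<open>With \<open>ln (ln 11)\<close> replaced by 4/5, the claim becomes the integer
    inequality \<open>6 ^ 5 \<le> 11 ^ 4\<close>.\<close>
  have "5 * ln (6::real) = ln (6 ^ 5)" by (simp only: ln_realpow)
  also have "\<dots> \<le> ln (11 ^ 4)" by simp
  also have "\<dots> = 4 * ln 11" by (simp only: ln_realpow)
  finally have "ln 6 \<le> ln 11 * (4 / 5 :: real)" by simp
  also have "\<dots> < ln 11 * ln (ln 11)" using * by (intro mult_strict_left_mono) auto
  finally show ?thesis .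
qed

text \<open>The 3/4 is 1/4 for the prime 2 plus the constant 1/2 of
  \<open>sum_inverse_le_ln\<close>; \<open>2 * ln 3\<close> comes from bounding half of the largest
  exponent of an odd prime.\<close>

lemma three_quarters_less: "3 / 4 < ln (2 * ln (3::real))"
proof -
  have "13 / 12 < ln (3::real)" using less_ln_of_power[of 12 3 13] by (simp add: power_divide)
  moreover have "3 / 4 < ln (13 / 6 :: real)"
    using less_ln_of_power[of 4 "13/6" 3] by (simp add: power_divide)
  ultimately show ?thesis
    using ln_less_cancel_iff[of "13/6::real" "2 * ln 3"] by linarith
qed

text \<open>Applying \<open>ln x \<le> x - 1\<close> to \<open>x = M / (M + 1)\<close> shows that
  each new term is at most an increment of the logarithm; these telescope from the value 1/2 at
  \<open>M = 2\<close>.\<close>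

lemma sum_inverse_le_ln:
  assumes "M \<ge> 2"
  shows "(\<Sum>k = 2..M. 1 / real k) \<le> 1 / 2 + ln (M / 2)"
  using assms
proof (induction M rule: dec_induct)
  case (step M)
  have "ln (real M / real (Suc M)) \<le> real M / real (Suc M) - 1"
    using step by (intro ln_le_minus_one) auto
  also have "\<dots> = - (1 / real (Suc M))" by (simp add: field_simps)
  finally have "1 / real (Suc M) \<le> ln (real (Suc M) / 2) - ln (M / 2)"
    using step by (simp add: ln_div)
  with step show ?case by simp
qed simp

section \<open>Prime powers that can be missing\<close>

text \<open>A superset of the missing pairs that depends on the value \<open>N\<close> alone and not
  on the enumeration. The last inequality is not strict because a pair of value exactly
  \<open>N\<close> may come after the first \<open>m\<close> pairs.\<close>

definition gap_pairs :: "nat \<Rightarrow> (nat \<times> nat) set" where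
  "gap_pairs N = {(p, k). prime p \<and> k \<ge> 2 \<and> p ^ k \<le> N \<and> N \<le> pair_value (p, k)}"

text \<open>Exponents \<open>j < k\<close> of one prime would give
  \<open>N < p ^ Suc j \<le> p ^ k \<le> N\<close>.\<close>

lemma inj_on_fst_gap_pairs: "inj_on fst (gap_pairs N)"
proof -
  have *: False if "(p, j) \<in> gap_pairs N" "(p, k) \<in> gap_pairs N" "j < k" for p j k
  proof -
    have p: "p \<ge> 2" using that prime_ge_2_nat by (auto simp: gap_pairs_def)
    have "N \<le> pair_value (p, j)" using that by (simp add: gap_pairs_def)
    also have "\<dots> < p ^ Suc j" by (rule pair_value_less_power_Suc[OF p])
    also have "\<dots> \<le> p ^ k" using p \<open>j < k\<close> by (intro power_increasing) auto
    also have "\<dots> \<le> N" using that by (simp add: gap_pairs_def)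
    finally show False by simp
  qed
  show ?thesis
  proof (rule inj_onI)
    fix x y assume xy: "x \<in> gap_pairs N" "y \<in> gap_pairs N" "fst x = fst y"
    then obtain p j k where "x = (p, j)" "y = (p, k)" by (metis prod.collapse)
    with xy *[of p j k] *[of p k j] show "x = y" by (metis linorder_neqE_nat)
  qed
qed

text \<open>Primes \<open>p < q\<close> with one exponent would give
  \<open>N < Suc p ^ k \<le> q ^ k \<le> N\<close>.\<close>

lemma inj_on_snd_gap_pairs: "inj_on snd (gap_pairs N)"
proof -
  have *: False if "(p, k) \<in> gap_pairs N" "(q, k) \<in> gap_pairs N" "p < q" for p q k
  proof -
    have "N \<le> pair_value (p, k)" using that by (simp add: gap_pairs_def)
    also have "\<dots> < Suc p ^ k" by (rule pair_value_less_Suc_power)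
    also have "\<dots> \<le> q ^ k" using \<open>p < q\<close> by (intro power_mono) auto
    also have "\<dots> \<le> N" using that by (simp add: gap_pairs_def)
    finally show False by simp
  qed
  show ?thesis
  proof (rule inj_onI)
    fix x y assume xy: "x \<in> gap_pairs N" "y \<in> gap_pairs N" "snd x = snd y"
    then obtain p q k where "x = (p, k)" "y = (q, k)" by (metis prod.collapse)
    with xy *[of p k q] *[of q k p] show "x = y" by (metis linorder_neqE_nat)
  qed
qed

lemma fst_gap_pairs_bounds:
  assumes "x \<in> gap_pairs N"
  shows "fst x \<ge> 2" "fst x * fst x \<le> N"
proof -
  obtain p k where x: "x = (p, k)" by fastforce
  then have p: "p \<ge> 2" and k: "k \<ge> 2" "p ^ k \<le> N"
    using assms prime_ge_2_nat by (auto simp: gap_pairs_def)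
  have "p ^ 2 \<le> p ^ k" using p k by (intro power_increasing) auto
  then show "fst x \<ge> 2" "fst x * fst x \<le> N" using x p k by (simp_all add: power2_eq_square)
qed

lemma finite_gap_pairs: "finite (gap_pairs N)"
proof (rule finite_imageD[OF _ inj_on_fst_gap_pairs], rule finite_subset)
  show "fst ` gap_pairs N \<subseteq> {..N}"
  proof
    fix p assume "p \<in> fst ` gap_pairs N"
    then obtain x where "x \<in> gap_pairs N" "p = fst x" by blast
    with fst_gap_pairs_bounds[of x N] have "p \<le> p * p" "p * p \<le> N" by simp_all
    then have "p \<le> N" by (rule order_trans)
    then show "p \<in> {..N}" by simp
  qed
qed simp

section \<open>The total weight of the missing prime powers\<close>

lemma sum_ln_gap_pairs_le:
  assumes "fst ` gap_pairs N \<subseteq> A" "finite A" "\<And>a. a \<in> A \<Longrightarrow> a \<ge> 1"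
  shows "(\<Sum>x\<in>gap_pairs N. ln (real (fst x))) \<le> (\<Sum>a\<in>A. ln (real a))"
proof -
  have "(\<Sum>x\<in>gap_pairs N. ln (real (fst x))) = (\<Sum>a\<in>fst ` gap_pairs N. ln (real a))"
    by (simp add: sum.reindex[OF inj_on_fst_gap_pairs])
  also have "\<dots> \<le> (\<Sum>a\<in>A. ln (real a))"
    using assms by (intro sum_mono2) auto
  finally show ?thesis .
qed

text \<open>Each prime occurs at most once, and its square is at most \<open>N\<close>. So nothing
  occurs at 3, only 2 can occur from 5 to 8, and only 2 and 3 from 11 to 15. By monotonicity the
  right-hand side need only be estimated at 3, 5 and 11.\<close>

lemma sum_ln_gap_pairs_small:
  assumes "3 \<le> N" "N < 16" "N \<notin> {4, 9, 10}"
  shows "(\<Sum>x\<in>gap_pairs N. ln (real (fst x))) < ln N * ln (ln N)"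
proof -
  have fst_lt: "p < b" if "p \<in> fst ` gap_pairs N" "N < b * b" for p b
  proof (rule ccontr)
    assume "\<not> p < b"
    then have "b * b \<le> p * p" by (intro mult_mono) auto
    also have "\<dots> \<le> N" using that(1) fst_gap_pairs_bounds(2) by auto
    finally show False using that(2) by simp
  qed
  have fst_ge: "2 \<le> p" if "p \<in> fst ` gap_pairs N" for p
    using that fst_gap_pairs_bounds(1) by auto
  consider "N = 3" | "5 \<le> N" "N < 9" | "11 \<le> N" using assms by auto linarith
  then show ?thesis
  proof cases
    case 1
    have "fst ` gap_pairs N \<subseteq> {}" using fst_lt[of _ 2] fst_ge 1 by fastforce
    then have "gap_pairs N = {}" by simp
    then show ?thesis using ln_mult_ln_ln_mono(1)[of 3 3] 1 by simp
  next
    case 2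
    have "fst ` gap_pairs N \<subseteq> {2}" using fst_lt[of _ 3] fst_ge 2 by fastforce
    then have "(\<Sum>x\<in>gap_pairs N. ln (real (fst x))) \<le> ln 2"
      by (rule order_trans[OF sum_ln_gap_pairs_le]) auto
    then show ?thesis using ln_2_less ln_mult_ln_ln_mono(2)[of 5 N] 2 by simp
  next
    case 3
    have "fst ` gap_pairs N \<subseteq> {2, 3}" using fst_lt[of _ 4] fst_ge assms by fastforce
    then have "(\<Sum>x\<in>gap_pairs N. ln (real (fst x))) \<le> ln 2 + ln 3"
      by (rule order_trans[OF sum_ln_gap_pairs_le]) auto
    also have "\<dots> = ln (6::real)" using ln_mult_pos[of "2::real" 3] by simp
    finally show ?thesis using ln_6_less ln_mult_ln_ln_mono(2)[of 11 N] 3 by simp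
  qed
qed

lemma sum_ln_gap_pairs_large:
  assumes "16 \<le> N"
  shows "(\<Sum>x\<in>gap_pairs N. ln (real (fst x))) < ln N * ln (ln N)"
proof -
  define L where "L = ln (real N)"
  \<comment> \<open>An odd prime has \<open>ln p \<ge> ln 3\<close>, so \<open>M\<close> caps the
    exponents in \<open>G3\<close>. The prime 2 is split off because a cap with \<open>ln 2\<close>
    would be too weak: \<open>1 / 2 > ln (2 * ln 2)\<close>.\<close>
  define M where "M = nat \<lfloor>L / ln 3\<rfloor>"
  define G2 where "G2 = {x \<in> gap_pairs N. fst x = 2}"
  define G3 where "G3 = gap_pairs N - G2"
  have fin: "finite G2" "finite G3" using finite_gap_pairs by (auto simp: G2_def G3_def)
  \<comment> \<open>The threshold \<open>16 = 2 ^ 4\<close> limits the share of the prime 2 to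
    \<open>L / 4\<close>.\<close>
  have "ln (2 ^ 4) \<le> L" unfolding L_def using assms by (subst ln_le_cancel_iff) auto
  then have L4: "4 * ln 2 \<le> L" by (subst (asm) ln_realpow) auto
  then have L0: "L > 0" using ln_gt_zero[of "2::real"] by linarith
  have "ln (3 ^ 2) \<le> L" unfolding L_def using assms by (subst ln_le_cancel_iff) auto
  then have "2 * ln 3 \<le> L" by (subst (asm) ln_realpow) auto
  then have "2 \<le> L / ln 3" by (simp add: field_simps)
  then have M2: "M \<ge> 2" unfolding M_def by linarith
  have M_le: "M \<le> L / ln 3" using L0 unfolding M_def by simp

  have "(\<Sum>x\<in>G2. ln (real (fst x))) \<le> ln 2"
  proof -
    have "inj_on fst G2" by (rule inj_on_subset[OF inj_on_fst_gap_pairs]) (auto simp: G2_def)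
    then have "card G2 = card (fst ` G2)" by (simp add: card_image)
    also have "\<dots> \<le> card {2::nat}" by (rule card_mono) (auto simp: G2_def)
    finally have "real (card G2) * ln 2 \<le> 1 * ln 2" by (intro mult_right_mono) auto
    moreover have "(\<Sum>x\<in>G2. ln (real (fst x))) = real (card G2) * ln 2"
      by (simp add: G2_def)
    ultimately show ?thesis by simp
  qed
  then have S2: "(\<Sum>x\<in>G2. ln (real (fst x))) \<le> L * (1 / 4)" using L4 by simp

  have G3: "ln (real (fst x)) \<le> L * (1 / real (snd x)) \<and> snd x \<in> {2..M}" if "x \<in> G3" for x
  proof -
    obtain p k where x: "x = (p, k)" by fastforce
    then have p: "prime p" and k: "k \<ge> 2" "p ^ k \<le> N" and "p \<noteq> 2"
      using that by (auto simp: gap_pairs_def G3_def G2_def)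
    then have p3: "p \<ge> 3" using prime_ge_2_nat[of p] by linarith
    have "real p ^ k \<le> N" using k by (metis of_nat_le_iff of_nat_power)
    then have "ln (real p ^ k) \<le> L" unfolding L_def using p3 assms by (subst ln_le_cancel_iff) auto
    then have kp: "k * ln p \<le> L" using p3 by (simp add: ln_realpow)
    have "k * ln 3 \<le> k * ln p" using p3 by (intro mult_left_mono) auto
    then have "k \<le> L / ln 3" using kp by (simp add: field_simps)
    then have "k \<le> M" unfolding M_def by linarith
    with kp k show ?thesis by (simp add: x field_simps)
  qed
  \<comment> \<open>Distinct exponents allow the sum over \<open>G3\<close> to be reindexed by a
    subset of \<open>{2..M}\<close>, which turns it into part of a harmonic sum.\<close>
  have inj: "inj_on snd G3" by (rule inj_on_subset[OF inj_on_snd_gap_pairs]) (auto simp: G3_def)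
  have "(\<Sum>x\<in>G3. ln (real (fst x))) \<le> (\<Sum>x\<in>G3. L * (1 / real (snd x)))"
    using G3 by (intro sum_mono) auto
  also have "\<dots> = (\<Sum>k\<in>snd ` G3. L * (1 / real k))" by (simp add: sum.reindex[OF inj])
  also have "\<dots> \<le> (\<Sum>k = 2..M. L * (1 / real k))"
    using G3 L0 by (intro sum_mono2) auto
  also have "\<dots> = L * (\<Sum>k = 2..M. 1 / real k)" by (simp only: sum_distrib_left)
  also have "\<dots> \<le> L * (1 / 2 + ln (M / 2))"
    using L0 sum_inverse_le_ln[OF M2] by (intro mult_left_mono) auto
  finally have S3: "(\<Sum>x\<in>G3. ln (real (fst x))) \<le> L * (1 / 2 + ln (M / 2))" .

  have "ln (M / 2) \<le> ln (L / (2 * ln 3))"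
    using M_le M2 L0 by (subst ln_le_cancel_iff) (auto simp: field_simps)
  also have "\<dots> = ln L - ln (2 * ln 3)" using L0 by (intro ln_divide_pos) auto
  finally have "3 / 4 + ln (M / 2) < ln L" using three_quarters_less by linarith
  then have "L * (3 / 4 + ln (M / 2)) < L * ln L" using L0 by (intro mult_strict_left_mono)
  moreover have "(\<Sum>x\<in>gap_pairs N. ln (real (fst x)))
      = (\<Sum>x\<in>G2. ln (real (fst x))) + (\<Sum>x\<in>G3. ln (real (fst x)))"
    unfolding G3_def using finite_gap_pairs
    by (subst sum.subset_diff[of G2 "gap_pairs N"]) (auto simp: G2_def)
  ultimately show ?thesis using S2 S3 by (simp add: L_def algebra_simps)
qed

section \<open>The first pairs\<close>

text \<open>Closure under smaller exponents makes the exponents paired with \<open>p\<close> exactly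
  \<open>1, ..., k_p\<close>, so \<open>k_p * ln p\<close> is a sum of \<open>ln p\<close> over
  these pairs. This gives \<open>ln n\<close> the same shape as the psi function.\<close>

lemma ln_pairs_number:
  assumes fin: "finite E" and sub: "E \<subseteq> prime_pairs"
    and down: "\<And>p k j. (p, k) \<in> E \<Longrightarrow> 1 \<le> j \<Longrightarrow> j \<le> k \<Longrightarrow> (p, j) \<in> E"
  shows "ln (real (pairs_number E)) = (\<Sum>x\<in>E. ln (real (fst x)))"
proof -
  define P where "P = {p. prime p \<and> max_exponent E p \<noteq> 0}"
  \<comment> \<open>For a \<open>p\<close> that does not occur, the default exponent 0 makes the
    interval empty, as required.\<close>
  have sections: "{k. (p, k) \<in> E} = {1..max_exponent E p}" for p
  proof (cases "\<exists>k. (p, k) \<in> E")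
    case True
    have "finite {k. (p, k) \<in> E}"
      by (rule finite_subset[of _ "snd ` E"]) (use fin in \<open>force+\<close>)
    moreover have max: "max_exponent E p = Max {k. (p, k) \<in> E}"
      using True by (simp add: max_exponent_def)
    ultimately have "(p, max_exponent E p) \<in> E" "\<And>k. (p, k) \<in> E \<Longrightarrow> k \<le> max_exponent E p"
      using Max_in[of "{k. (p, k) \<in> E}"] True by auto
    then show ?thesis using down sub by (auto simp: prime_pairs_def)
  qed (simp add: max_exponent_def)
  have E: "E = Sigma P (\<lambda>p. {1..max_exponent E p})"
  proof (rule set_eqI)
    fix x :: "nat \<times> nat"
    obtain p k where x: "x = (p, k)" by fastforce
    have "(p, k) \<in> E \<longleftrightarrow> k \<in> {1..max_exponent E p}" using sections[of p] by blast
    then show "x \<in> E \<longleftrightarrow> x \<in> Sigma P (\<lambda>p. {1..max_exponent E p})"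
      using sub by (auto simp: x P_def prime_pairs_def)
  qed
  have "P \<subseteq> fst ` E"
  proof
    fix p assume "p \<in> P"
    then have "(p, 1) \<in> E" using sections[of p] by (auto simp: P_def)
    then show "p \<in> fst ` E" by force
  qed
  then have finP: "finite P" using fin finite_subset by blast
  have pos: "p > 0" if "p \<in> P" for p using that prime_gt_0_nat by (simp add: P_def)
  have "ln (real (pairs_number E)) = (\<Sum>p\<in>P. ln (real p ^ max_exponent E p))"
    unfolding pairs_number_def P_def[symmetric] of_nat_prod of_nat_power
    using finP pos by (subst ln_prod) auto
  also have "\<dots> = (\<Sum>p\<in>P. \<Sum>k = 1..max_exponent E p. ln (real p))"
    using pos by (intro sum.cong) (auto simp: ln_realpow)
  also have "\<dots> = (\<Sum>x\<in>Sigma P (\<lambda>p. {1..max_exponent E p}). ln (real (fst x)))"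
    using finP by (subst sum.Sigma) (auto simp: case_prod_unfold)
  finally show ?thesis using E by simp
qed

section \<open>Initial segments of the enumeration\<close>

context
  fixes e :: "nat \<Rightarrow> nat \<times> nat" and m :: nat
  assumes enum: "pair_enumeration e" and m: "m \<ge> 1"
begin

lemma range_enum: "e ` {1..} = prime_pairs"
  using enum by (simp add: pair_enumeration_def bij_betw_def)

lemma enum_in_prime_pairs: "e m \<in> prime_pairs"
  using range_enum m by blast

lemma first_pairs_subset: "first_pairs e m \<subseteq> prime_pairs"
  using range_enum by (auto simp: first_pairs_def)

lemma not_in_first_pairs:
  assumes "x \<in> prime_pairs" "x \<notin> first_pairs e m"
  obtains i where "i > m" "e i = x"
proof -
  obtain i where "i \<ge> 1" "e i = x" using assms(1) range_enum by (metis atLeast_iff imageE)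
  moreover from this have "i > m" using assms(2) by (force simp: first_pairs_def)
  ultimately show ?thesis using that by blast
qed

lemma pair_value_first_pairs_le:
  assumes "x \<in> first_pairs e m"
  shows "pair_value x \<le> pair_value (e m)"
  using assms enum by (auto simp: first_pairs_def pair_enumeration_def)

lemma in_first_pairs:
  assumes "x \<in> prime_pairs" "pair_value x < pair_value (e m)"
  shows "x \<in> first_pairs e m"
proof (rule ccontr)
  assume "x \<notin> first_pairs e m"
  then obtain i where "i > m" "e i = x" using assms(1) not_in_first_pairs by blast
  then have "pair_value (e m) \<le> pair_value x"
    using enum m unfolding pair_enumeration_def by auto
  then show False using assms(2) by simp
qed

text \<open>If \<open>(p, 1)\<close> came after index \<open>m\<close>, then \<open>e m\<close>
  would also have value \<open>p\<close>. The tie rule rules out a first component below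
  \<open>p\<close>, and a first component never exceeds the value, so it would equal
  \<open>p\<close> and \<open>e m\<close> would be \<open>(p, 1)\<close> itself.\<close>

lemma prime_in_first_pairs:
  assumes p: "prime p" and le: "p \<le> pair_value (e m)"
  shows "(p, 1) \<in> first_pairs e m"
proof (rule ccontr)
  assume notin: "(p, 1) \<notin> first_pairs e m"
  have pp: "(p, 1) \<in> prime_pairs" using p by (simp add: prime_pairs_def)
  have v: "pair_value (p, 1) = p" by (simp add: pair_value_def)
  have eq: "pair_value (e m) = p" using in_first_pairs[OF pp] notin le v by fastforce
  obtain i where i: "i > m" "e i = (p, 1)" using not_in_first_pairs[OF pp notin] .
  obtain q j where qj: "e m = (q, j)" by fastforce
  have q: "(q, j) \<in> prime_pairs" using enum_in_prime_pairs qj by simp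
  have "\<not> q < p"
  proof
    assume "q < p"
    then have "i < m"
      using enum m i eq v qj unfolding pair_enumeration_def by (auto dest!: spec[of _ i])
    with i show False by simp
  qed
  then have "q = p" using pair_value_ge[OF q] eq qj by simp
  then have "j = 1" using pair_value_inj[OF _ pp, of j] q eq v qj by simp
  then have "e m = (p, 1)" using \<open>q = p\<close> qj by simp
  then show False using notin m by (force simp: first_pairs_def)
qed

text \<open>A smaller exponent of the same prime has a strictly smaller value, so the first
  \<open>m\<close> pairs are closed under lowering exponents.\<close>

lemma ln_pairs_number_first_pairs:
  "ln (real (pairs_number (first_pairs e m))) = (\<Sum>x\<in>first_pairs e m. ln (real (fst x)))"
proof (rule ln_pairs_number)
  fix p k j assume pk: "(p, k) \<in> first_pairs e m" and j: "1 \<le> j" "j \<le> k"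
  then have p: "prime p" using first_pairs_subset by (auto simp: prime_pairs_def)
  show "(p, j) \<in> first_pairs e m"
  proof (cases "j = k")
    case False
    then have "pair_value (p, j) < pair_value (p, k)"
      using p j by (intro pair_value_strict_mono) (auto simp: prime_gt_0_nat)
    also have "\<dots> \<le> pair_value (e m)" by (rule pair_value_first_pairs_le[OF pk])
    finally show ?thesis using p j by (intro in_first_pairs) (auto simp: prime_pairs_def)
  qed (use pk in simp)
qed (use first_pairs_subset in \<open>auto simp: first_pairs_def\<close>)

text \<open>Only \<open>(2, 1)\<close> has value at most 2. By monotonicity it would be both
  \<open>e 1\<close> and \<open>e m\<close>, against injectivity.\<close>

lemma pair_value_ge_3:
  assumes "m \<noteq> 1"
  shows "pair_value (e m) \<ge> 3"
proof (rule ccontr)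
  assume "\<not> pair_value (e m) \<ge> 3"
  have two: "x = (2, 1)" if "x \<in> prime_pairs" "pair_value x \<le> 2" for x
  proof -
    obtain q k where x: "x = (q, k)" by fastforce
    have q: "q = 2" using that x pair_value_ge[of q k] prime_ge_2_nat[of q]
      by (auto simp: prime_pairs_def)
    have "(2, 1) \<in> prime_pairs" by (simp add: prime_pairs_def)
    moreover have "pair_value (2, k) = pair_value (2, 1)"
      using that x q pair_value_ge[of 2 k] by (simp add: pair_value_def)
    ultimately show ?thesis using that x q pair_value_inj[of 2 k 1] by simp
  qed
  have "pair_value (e 1) \<le> pair_value (e m)"
    using enum m unfolding pair_enumeration_def by blast
  moreover have "e 1 \<in> prime_pairs" using range_enum by blast
  ultimately have "e 1 = (2, 1)" "e m = (2, 1)"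
    using two[of "e 1"] two[of "e m"] enum_in_prime_pairs \<open>\<not> pair_value (e m) \<ge> 3\<close> by simp_all
  then have "m = 1"
    using enum m unfolding pair_enumeration_def bij_betw_def inj_on_def by auto
  with assms show False ..
qed

end

text \<open>The lower bound is guarded by \<open>m \<noteq> 1\<close> because
  \<open>lower_bound_fails_at_1\<close> refutes it for \<open>m = 1\<close>.\<close>

theorem theorem7:
  fixes e :: "nat \<Rightarrow> nat \<times> nat" and m :: nat and z n :: real
  assumes "pair_enumeration e"
    and "m \<ge> 1"
  defines "z \<equiv> real (pair_value (e m))"
    and "n \<equiv> real (pairs_number (first_pairs e m))"
  shows "(m \<noteq> 1 \<longrightarrow> chebyshev_psi z - ln z * ln (ln z) < ln n) \<and> ln n \<le> chebyshev_psi z"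
proof -
  define N where "N = pair_value (e m)"
  define E where "E = first_pairs e m"
  define D where "D = {(p, k). prime p \<and> k \<ge> 1 \<and> p ^ k \<le> N}"
  have z: "z = real N" by (simp add: z_def N_def)
  have "{(p, k). prime p \<and> k \<ge> 1 \<and> real (p ^ k) \<le> z} = D"
    unfolding D_def z of_nat_le_iff ..
  then have psi: "chebyshev_psi z = (\<Sum>x\<in>D. ln (real (fst x)))"
    by (simp add: chebyshev_psi_def case_prod_unfold)
  have ln_n: "ln n = (\<Sum>x\<in>E. ln (real (fst x)))"
    unfolding n_def E_def by (rule ln_pairs_number_first_pairs[OF assms(1,2)])
  have nonneg: "0 \<le> ln (real (fst x))" if "x \<in> D \<union> gap_pairs N" for x
    using that by (auto simp: D_def gap_pairs_def dest!: prime_ge_1_nat)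

  have ED: "E \<subseteq> D"
  proof
    fix x assume x: "x \<in> E"
    obtain p k where pk: "x = (p, k)" by fastforce
    have "prime p" "k \<ge> 1"
      using x pk first_pairs_subset[OF assms(1,2)] by (auto simp: E_def prime_pairs_def)
    moreover have "pair_value (p, k) \<le> N"
      using pair_value_first_pairs_le[OF assms(1,2)] x by (simp add: E_def N_def pk)
    ultimately show "x \<in> D" using power_le_pair_value[of k p] by (simp add: pk D_def)
  qed
  \<comment> \<open>A missing pair is not of the form \<open>(p, 1)\<close>, since all primes up to
    \<open>N\<close> are present, and its value is not below \<open>N\<close>.\<close>
  have gap: "D - E \<subseteq> gap_pairs N"
  proof
    fix x assume x: "x \<in> D - E"
    obtain p k where pk: "x = (p, k)" by fastforce
    have p: "prime p" "k \<ge> 1" "p ^ k \<le> N" using x pk by (auto simp: D_def)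
    have "k \<noteq> 1" using prime_in_first_pairs[OF assms(1,2), of p] p x pk
      by (auto simp: E_def N_def)
    moreover have "\<not> pair_value (p, k) < N"
      using in_first_pairs[OF assms(1,2), of x] p x pk by (auto simp: E_def N_def prime_pairs_def)
    ultimately show "x \<in> gap_pairs N" using p pk by (simp add: gap_pairs_def)
  qed
  have "finite E" by (simp add: E_def first_pairs_def)
  then have fin: "finite D"
    using finite_subset[OF gap finite_gap_pairs] by simp
  \<comment> \<open>The difference is exactly the weight of the missing pairs: being nonnegative it
    gives the upper bound for \<open>ln n\<close>, and its estimate over \<open>gap_pairs N\<close>
    gives the lower one.\<close>
  have diff: "chebyshev_psi z - ln n = (\<Sum>x\<in>D - E. ln (real (fst x)))"
    unfolding psi ln_n by (simp add: sum_diff[OF fin ED])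
  have "chebyshev_psi z - ln z * ln (ln z) < ln n" if "m \<noteq> 1"
  proof -
    have "chebyshev_psi z - ln n \<le> (\<Sum>x\<in>gap_pairs N. ln (real (fst x)))"
      unfolding diff using gap nonneg by (intro sum_mono2 finite_gap_pairs) auto
    also have "\<dots> < ln z * ln (ln z)"
    proof (cases "N < 16")
      case True
      have "N \<notin> {4, 9, 10}"
        using pair_value_notin enum_in_prime_pairs[OF assms(1,2)] unfolding N_def
        by (cases "e m") auto
      then show ?thesis
        unfolding z using pair_value_ge_3[OF assms(1,2) that] True
        by (intro sum_ln_gap_pairs_small) (auto simp: N_def)
    qed (use sum_ln_gap_pairs_large z in auto)
    finally show ?thesis by simp
  qed
  moreover have "ln n \<le> chebyshev_psi z"
    using diff sum_nonneg[of "D - E" "\<lambda>x. ln (real (fst x))"] nonneg by auto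
  ultimately show ?thesis by blast
qed

end
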